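(* Let $\alpha>0$. The fractional spline polynomials $S_n^{(\alpha)}$ satisfy the ordinary generating function $$\sum_{n=0}^{\infty}S_n^{(\alpha)}(x)\,t^n=\sum_{k=0}^{\infty}(-1)^k\binom{\alpha+1}{k}(x-k)_+^{\alpha}\,E_{1,\alpha+1}\big((x-k)_+\,t\big),$$ where $E_{a,b}(z)=\sum_{n=0}^{\infty}\frac{z^n}{\Gamma(an+b)}$ denotes the Mittag--Leffler function.
   Context: For $\alpha>0$ and $n\in\mathbb{N}_0$, the fractional spline polynomials are the functions of $x\in\mathbb{R}$ defined by $$S_n^{(\alpha)}(x)=\frac{1}{\Gamma(\alpha+n+1)}\sum_{k=0}^{\infty}(-1)^k\binom{\alpha+1}{k}(x-k)_+^{\alpha+n}.$$ Here $y_+^{\beta}=y^\beta$ if $y>0$ and $y_+^\beta=0$ if $y\le 0$, $y_+=\max(y,0)$, and $\binom{\beta}{k}$ is the generalized binomial coefficient $\beta(\beta-1)\cdots(\beta-k+1)/k!$. *)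

theory Defs
  imports "HOL-Analysis.Analysis"
begin

definition pos_part :: "real \<Rightarrow> real" where
  "pos_part y = max y 0"

definition trunc_power :: "real \<Rightarrow> real \<Rightarrow> real" where
  "trunc_power y \<beta> = (if y > 0 then y powr \<beta> else 0)"

text \<open>
  For every \<open>x\<close> only the finitely many terms with \<open>k < x\<close> are nonzero, so the series below
  always converges and \<open>suminf\<close> denotes its actual sum.
\<close>

definition frac_spline :: "real \<Rightarrow> nat \<Rightarrow> real \<Rightarrow> real" where
  "frac_spline \<alpha> n x =
     1 / Gamma (\<alpha> + real n + 1) *
       (\<Sum>k. (-1) ^ k * ((\<alpha> + 1) gchoose k) * trunc_power (x - real k) (\<alpha> + real n))"

text \<open>
  The parameters are real; the argument ranges over any complete normed field over the reals,
  which covers both the real and the complex Mittag--Leffler function. The series converges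
  everywhere when \<open>a > 0\<close>.
\<close>

definition mittag_leffler ::
    "real \<Rightarrow> real \<Rightarrow> 'a::{real_normed_field,banach} \<Rightarrow> 'a" where
  "mittag_leffler a b z = (\<Sum>n. z ^ n / of_real (Gamma (a * real n + b)))"

end

theory Submission
  imports Defs
begin

text \<open>
  For fixed \<open>x\<close> only the indices \<open>k < x\<close> contribute, so the sums over \<open>n\<close> and \<open>k\<close> may be
  interchanged as a finite sum of convergent series; for each \<open>k\<close>, the factorisation
  \<open>(x - k)\<^sub>+ powr (\<alpha> + n) = (x - k)\<^sub>+ powr \<alpha> * (x - k)\<^sub>+ ^ n\<close> produces the Mittag-Leffler series.
\<close>

text \<open>Since Gamma(s + 1) = s Gamma(s), consecutive terms have norm ratio
  \<open>norm z / (real n + b)\<close>, which tends to 0. The factor \<open>1 *\<close> matches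
  \<open>mittag_leffler\<close> unfolded at first parameter 1.\<close>

lemma summable_mittag_leffler_1:
  fixes z :: "'a::{real_normed_field,banach}"
  assumes "b > 0"
  shows "summable (\<lambda>n. z ^ n / of_real (Gamma (1 * real n + b)))"
proof (rule summable_ratio_test)
  show "(1/2 :: real) < 1" by simp
next
  \<comment> \<open>Beyond this threshold the ratio is at most 1/2.\<close>
  fix n assume n: "nat \<lceil>2 * norm z\<rceil> \<le> n"
  have pos: "real n + b > 0" using assms by simp
  have "2 * norm z \<le> real n + b"
    using n assms by linarith
  then have ratio: "norm z / (real n + b) \<le> 1/2"
    using pos by (simp add: field_simps)
  have "Gamma (real (Suc n) + b) = (real n + b) * Gamma (real n + b)"
    using Gamma_plus1[of "real n + b"] pos nonpos_Ints_nonpos[of "real n + b"]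
    by (force simp: add_ac)
  then have "norm (z ^ Suc n / of_real (Gamma (1 * real (Suc n) + b)) :: 'a) =
      norm z / (real n + b) * norm (z ^ n / of_real (Gamma (1 * real n + b)) :: 'a)"
    using pos by (simp add: norm_divide norm_mult norm_power abs_mult add_ac del: of_real_add)
  also have "\<dots> \<le> 1/2 * norm (z ^ n / of_real (Gamma (1 * real n + b)) :: 'a)"
    by (rule mult_right_mono[OF ratio norm_ge_zero])
  finally show "norm (z ^ Suc n / of_real (Gamma (1 * real (Suc n) + b)) :: 'a) \<le>
      1/2 * norm (z ^ n / of_real (Gamma (1 * real n + b)) :: 'a)" .
qed

text \<open>For y > 0 this is the exponent law. For y \<le> 0 the factor
  \<open>trunc_power y \<beta>\<close> is 0, so the value \<open>0 ^ 0 = 1\<close> at n = 0 does no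
  harm.\<close>

lemma trunc_power_add_nat:
  "trunc_power y (\<beta> + real n) = trunc_power y \<beta> * pos_part y ^ n"
  by (simp add: trunc_power_def pos_part_def powr_add powr_realpow)

text \<open>This is the inner series over n for a single k, to be used with y = x - k.\<close>

lemma trunc_power_mittag_leffler_sums:
  fixes t :: "'a::{real_normed_field,banach}"
  assumes "\<alpha> > 0"
  shows "(\<lambda>n. of_real (trunc_power y (\<alpha> + real n) / Gamma (\<alpha> + real n + 1)) * t ^ n) sums
    (of_real (trunc_power y \<alpha>) * mittag_leffler 1 (\<alpha> + 1) (of_real (pos_part y) * t))"
proof -
  have "(\<lambda>n. (of_real (pos_part y) * t) ^ n / of_real (Gamma (1 * real n + (\<alpha> + 1)))) sums
      mittag_leffler 1 (\<alpha> + 1) (of_real (pos_part y) * t)"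
    unfolding mittag_leffler_def
    using assms by (intro summable_sums summable_mittag_leffler_1) simp
  from sums_mult[OF this, of "of_real (trunc_power y \<alpha>)"] show ?thesis
    by (simp add: trunc_power_add_nat power_mult_distrib ac_simps)
qed

theorem theorem5p23:
  fixes \<alpha> x :: real and t :: "'a::{real_normed_field,banach}"
  assumes "\<alpha> > 0"
  shows "summable (\<lambda>n. of_real (frac_spline \<alpha> n x) * t ^ n) \<and>
         summable (\<lambda>k. of_real ((-1) ^ k * ((\<alpha> + 1) gchoose k) * trunc_power (x - real k) \<alpha>) *
           mittag_leffler 1 (\<alpha> + 1) (of_real (pos_part (x - real k)) * t)) \<and>
         (\<Sum>n. of_real (frac_spline \<alpha> n x) * t ^ n) =
         (\<Sum>k. of_real ((-1) ^ k * ((\<alpha> + 1) gchoose k) * trunc_power (x - real k) \<alpha>) *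
           mittag_leffler 1 (\<alpha> + 1) (of_real (pos_part (x - real k)) * t))"
proof -
  define c where "c = (\<lambda>k. (-1) ^ k * ((\<alpha> + 1) gchoose k))"
  \<comment> \<open>Every natural k \<ge> N satisfies k \<ge> x, so its truncated power is 0; for x
    \<le> 0 both sums over k are empty.\<close>
  define N where "N = nat \<lceil>x\<rceil>"
  define E where "E = (\<lambda>k. mittag_leffler 1 (\<alpha> + 1) (of_real (pos_part (x - real k)) * t))"
  have vanish: "trunc_power (x - real k) \<beta> = 0" if "k \<notin> {..<N}" for k \<beta>
    using that unfolding trunc_power_def N_def by (simp; linarith)
  have spline: "frac_spline \<alpha> n x =
      (\<Sum>k<N. c k * (trunc_power (x - real k) (\<alpha> + real n) / Gamma (\<alpha> + real n + 1)))" for n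
    unfolding frac_spline_def c_def
    by (subst suminf_finite[of "{..<N}"]) (simp_all add: vanish sum_distrib_left)
  \<comment> \<open>The interchange of sums: \<open>c k\<close> does not depend on n, and finitely
    many convergent series add termwise.\<close>
  have "(\<lambda>n. \<Sum>k<N. of_real (c k) *
      (of_real (trunc_power (x - real k) (\<alpha> + real n) / Gamma (\<alpha> + real n + 1)) * t ^ n)) sums
      (\<Sum>k<N. of_real (c k) * (of_real (trunc_power (x - real k) \<alpha>) * E k))"
    unfolding E_def by (intro sums_sum sums_mult trunc_power_mittag_leffler_sums assms)
  then have lhs: "(\<lambda>n. of_real (frac_spline \<alpha> n x) * t ^ n) sums
      (\<Sum>k<N. of_real (c k * trunc_power (x - real k) \<alpha>) * E k)"
    by (simp add: spline sum_distrib_right mult.assoc)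
  \<comment> \<open>For k \<ge> N the factor \<open>E k\<close> need not vanish; the truncated power
    kills the term.\<close>
  have rhs: "(\<lambda>k. of_real (c k * trunc_power (x - real k) \<alpha>) * E k) sums
      (\<Sum>k<N. of_real (c k * trunc_power (x - real k) \<alpha>) * E k)"
    by (rule sums_finite) (simp_all add: vanish)
  show ?thesis
    using lhs rhs unfolding c_def E_def by (simp add: sums_iff)
qed

end
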